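(* Let $T:[1,\infty)\to(0,\infty)$ be a non-decreasing function of order $L\in(0,\infty)$, and let $\varepsilon>0$. Then the set $$K_1=\{r\ge1: r^{L-\varepsilon}\le T(r)\le r^{L+\varepsilon}\}$$ satisfies $\overline{\operatorname{logdens}}(K_1)\ge\dfrac{\varepsilon}{L}$.
   Context: The order of a non-decreasing function $T:[1,\infty)\to(0,\infty)$ is $\limsup_{r\to\infty}\frac{\log T(r)}{\log r}$. The upper logarithmic density of a set $D\subset[1,\infty)$ is $$\overline{\operatorname{logdens}}(D)=\limsup_{r\to\infty}\frac{1}{\log r}\int_{D\cap[1,r]}\frac{dt}{t}.$$
   Formalization: The bound proved is min(1, ε/L) instead of ε/L: for ε > L the claim as stated is false, since an upper logarithmic density is at most 1 (e.g. T(r)=r, L=1, ε=2); for ε ≤ L the bound is exactly ε/L. *)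

theory Defs
  imports "HOL-Analysis.Analysis"
begin

definition growth_order :: "(real \<Rightarrow> real) \<Rightarrow> ereal" where
  "growth_order T = Limsup at_top (\<lambda>r. ereal (ln (T r) / ln r))"

(* Meant for Lebesgue measurable D contained in [1,\<infinity>): the integral of a non-measurable
   set is 0 by convention. *)
definition upper_logdens :: "real set \<Rightarrow> ereal" where
  "upper_logdens D =
     Limsup at_top (\<lambda>r. ereal (1 / ln r * (LINT t:D \<inter> {1..r}|lebesgue. 1 / t)))"

end

theory Submission
  imports Defs
begin

text \<open>
  If \<open>T\<close> is nearly as large as \<open>r powr L\<close> at some point \<open>r\<close>, then monotonicity keeps it above
  \<open>x powr (L - e)\<close> for all \<open>x\<close> from \<open>r\<close> up to a fixed power \<open>s = r powr p\<close>, while the upper bound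
  holds everywhere far out. The interval from \<open>r\<close> to \<open>s\<close> has logarithmic measure \<open>(1 - 1/p) ln s\<close>,
  and \<open>1 - 1/p\<close> can be brought arbitrarily close to \<open>e / L\<close>. Letting \<open>e\<close> tend to \<open>\<epsilon>\<close> or to \<open>L\<close>,
  whichever is smaller, gives the bound.
\<close>

lemma set_integrable_inverse_Icc:
  fixes a b :: real
  assumes "0 < a"
  shows "set_integrable lborel {a..b} (\<lambda>t. 1 / t)"
  using assms by (intro borel_integrable_atLeastAtMost') (auto intro!: continuous_intros)

lemma set_integral_inverse_Icc:
  fixes a b :: real
  assumes "0 < a" "a \<le> b"
  shows "(LINT t:{a..b}|lebesgue. 1 / t) = ln b - ln a"
proof -
  have "(LINT t:{a..b}|lborel. 1 / t) = ln b - ln a"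
    unfolding set_lebesgue_integral_def real_scaleR_def
  proof (subst mult.commute, rule integral_FTC_Icc_real)
    fix x assume "a \<le> x" "x \<le> b"
    with assms show "(ln has_real_derivative 1 / x) (at x)" "isCont (\<lambda>t. 1 / t) x"
      by (auto intro!: derivative_eq_intros continuous_intros)
  qed fact
  moreover have "(LINT t:{a..b}|lebesgue. 1 / t) = (LINT t:{a..b}|lborel. 1 / t)"
    unfolding set_lebesgue_integral_def
    by (rule integral_completion) simp
  ultimately show ?thesis by simp
qed

text \<open>Passing from \<open>{a..b}\<close> to \<open>D \<inter> {1..b}\<close> only adds a
  nonnegative contribution. Measurability of \<open>D\<close> secures integrability, without which
  the larger integral would default to 0.\<close>

lemma log_measure_ge_Icc:
  fixes D :: "real set"
  assumes "D \<in> sets lebesgue" "1 \<le> a" "a \<le> b" "{a..b} \<subseteq> D"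
  shows "ln b - ln a \<le> (LINT t:D \<inter> {1..b}|lebesgue. 1 / t)"
proof -
  have "integrable lborel (\<lambda>t. indicat_real {1..b} t *\<^sub>R (1 / t))"
    using set_integrable_inverse_Icc[of 1 b] unfolding set_integrable_def by simp
  then have "set_integrable lebesgue {1..b} (\<lambda>t. 1 / t)"
    unfolding set_integrable_def by (rule integrable_completion[THEN iffD2, rotated]) simp
  then have "set_integrable lebesgue (D \<inter> {1..b}) (\<lambda>t. 1 / t)"
    by (rule set_integrable_subset) (use assms(1) in auto)
  moreover from this have "set_integrable lebesgue {a..b} (\<lambda>t. 1 / t)"
    by (rule set_integrable_subset) (use assms in auto)
  ultimately have "(LINT t:{a..b}|lebesgue. 1 / t) \<le> (LINT t:D \<inter> {1..b}|lebesgue. 1 / t)"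
    unfolding set_integrable_def set_lebesgue_integral_def
    by (intro integral_mono) (use assms in \<open>auto simp: indicator_def\<close>)
  then show ?thesis
    using set_integral_inverse_Icc[of a b] assms by simp
qed

lemma borel_power_window:
  fixes T :: "real \<Rightarrow> real"
  assumes "mono_on {1..} T"
  shows "{r. r \<ge> 1 \<and> r powr a \<le> T r \<and> T r \<le> r powr b} \<in> sets borel"
proof -
  \<comment> \<open>Monotonicity is known on \<open>{1..}\<close> only. Extending by the constant
    \<open>T 1\<close> to the left gives a function monotone on the whole line, hence Borel, and the
    window does not see the change.\<close>
  have "mono (\<lambda>r. T (max 1 r))"
    using assms by (auto simp: mono_def mono_on_def)
  then have [measurable]: "(\<lambda>r. T (max 1 r)) \<in> borel_measurable borel"
    by (rule borel_measurable_mono)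
  have "{r \<in> space borel. r \<ge> 1 \<and> r powr a \<le> T (max 1 r) \<and> T (max 1 r) \<le> r powr b} \<in> sets borel"
    by measurable
  also have "{r \<in> space borel. r \<ge> 1 \<and> r powr a \<le> T (max 1 r) \<and> T (max 1 r) \<le> r powr b}
      = {r. r \<ge> 1 \<and> r powr a \<le> T r \<and> T r \<le> r powr b}"
    by (auto simp: max_def)
  finally show ?thesis .
qed

lemma eventually_le_powr_of_growth_order:
  assumes "\<And>r. r \<ge> 1 \<Longrightarrow> T r > 0" "growth_order T < ereal M"
  shows "\<forall>\<^sub>F r in at_top. T r \<le> r powr M"
proof -
  have "\<forall>\<^sub>F r in at_top. ereal (ln (T r) / ln r) < ereal M"
    using assms(2) unfolding growth_order_def by (rule Limsup_lessD)
  then show ?thesis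
    using eventually_gt_at_top[of 1]
  proof eventually_elim
    case (elim r)
    then have "ln (T r) \<le> ln (r powr M)" by (simp add: ln_powr field_simps)
    then show ?case
      using elim assms(1)[of r] by (subst (asm) ln_le_cancel_iff) auto
  qed
qed

text \<open>If the power bound failed eventually, the quotients of logarithms would eventually be at
  most \<open>M\<close>, and then so would their limsup.\<close>

lemma frequently_ge_powr_of_growth_order:
  assumes "\<And>r. r \<ge> 1 \<Longrightarrow> T r > 0" "ereal M < growth_order T"
  shows "\<exists>\<^sub>F r in at_top. r powr M \<le> T r"
  unfolding frequently_def
proof
  assume "\<forall>\<^sub>F r in at_top. \<not> r powr M \<le> T r"
  then have "\<forall>\<^sub>F r in at_top. ereal (ln (T r) / ln r) \<le> ereal M"
    using eventually_gt_at_top[of 1]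
  proof eventually_elim
    case (elim r)
    then have "ln (T r) \<le> ln (r powr M)"
      using assms(1)[of r] by (subst ln_le_cancel_iff) auto
    then show ?case using elim by (simp add: ln_powr field_simps)
  qed
  then have "growth_order T \<le> ereal M"
    unfolding growth_order_def by (rule Limsup_bounded)
  with assms(2) show False by simp
qed

text \<open>The cap at 1 matters when \<open>\<epsilon> > L\<close>: an upper logarithmic density
  never exceeds 1.\<close>

theorem corollary4p2:
  fixes T :: "real \<Rightarrow> real" and L \<epsilon> :: real
  assumes "\<And>r. r \<ge> 1 \<Longrightarrow> T r > 0"
    and "mono_on {1..} T"
    and "L > 0"
    and "growth_order T = ereal L"
    and "\<epsilon> > 0"
  shows "upper_logdens {r. r \<ge> 1 \<and> r powr (L - \<epsilon>) \<le> T r \<and> T r \<le> r powr (L + \<epsilon>)}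
           \<ge> ereal (min 1 (\<epsilon> / L))"
proof (rule ccontr)
  define K where "K = {r. r \<ge> 1 \<and> r powr (L - \<epsilon>) \<le> T r \<and> T r \<le> r powr (L + \<epsilon>)}"
  assume "\<not> ?thesis"
  then have "upper_logdens K < ereal (min 1 (\<epsilon> / L))"
    unfolding K_def by (simp only: not_le)
  then obtain x where x: "upper_logdens K < ereal x" "x < min 1 (\<epsilon> / L)"
    by (metis ereal_dense2 less_ereal.simps(1))
  \<comment> \<open>The separating value \<open>x\<close> may be negative; truncating at 0 keeps the
    exponent \<open>p\<close> below at least 1.\<close>
  define c where "c = max 0 x"
  have "c * L < min L \<epsilon>"
    using x(2) assms(3,5) unfolding c_def by (auto simp: max_def field_simps)
  \<comment> \<open>The three bounds serve in turn to make \<open>a + c * L\<close> less than the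
    order \<open>L\<close>, to make \<open>a\<close> positive, and to put \<open>a\<close> above
    \<open>L - \<epsilon>\<close>.\<close>
  then obtain e where e: "c * L < e" "e < L" "e < \<epsilon>"
    using dense[of "c * L" "min L \<epsilon>"] by auto
  have c: "0 \<le> c" "x \<le> c" unfolding c_def by auto
  define a where "a = L - e"
  have a: "0 < a" "a + c * L < L" using e by (auto simp: a_def)
  \<comment> \<open>Chosen so that \<open>s powr a = r powr (a + c * L)\<close> for
    \<open>s = r powr p\<close>: the lower bound for \<open>T\<close> at \<open>r\<close> is then
    just enough to cover all of \<open>{r..s}\<close>.\<close>
  define p where "p = (a + c * L) / a"
  have p: "1 \<le> p" "a * p = a + c * L"
    using a c assms(3) by (auto simp: p_def)
  have "\<forall>\<^sub>F r in at_top. ereal (1 / ln r * (LINT t:K \<inter> {1..r}|lebesgue. 1 / t)) < ereal x"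
    using x(1) unfolding upper_logdens_def by (rule Limsup_lessD)
  then obtain R1 where R1:
    "\<And>r. r \<ge> R1 \<Longrightarrow> 1 / ln r * (LINT t:K \<inter> {1..r}|lebesgue. 1 / t) < x"
    unfolding eventually_at_top_linorder by auto
  have "\<forall>\<^sub>F r in at_top. T r \<le> r powr (L + \<epsilon>)"
    using assms(4,5) by (intro eventually_le_powr_of_growth_order assms(1)) auto
  then obtain R2 where R2: "\<And>r. r \<ge> R2 \<Longrightarrow> T r \<le> r powr (L + \<epsilon>)"
    unfolding eventually_at_top_linorder by auto
  have "\<exists>\<^sub>F r in at_top. r powr (a + c * L) \<le> T r"
    using assms(4) a by (intro frequently_ge_powr_of_growth_order assms(1)) auto
  then obtain r where r: "r > max 1 (max R1 R2)" "r powr (a + c * L) \<le> T r"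
    unfolding frequently_def eventually_at_top_dense by blast
  define s where "s = r powr p"
  have rs: "r \<le> s"
    using powr_mono[OF p(1), of r] r(1) by (simp add: s_def)
  have ln_s: "ln s = p * ln r" "0 < ln r" "0 < ln s"
    using r(1) p(1) by (auto simp: s_def ln_powr)
  have "{r..s} \<subseteq> K"
  proof
    fix y assume y: "y \<in> {r..s}"
    have "y powr (L - \<epsilon>) \<le> y powr a"
      using y r(1) e by (intro powr_mono) (auto simp: a_def)
    also have "\<dots> \<le> s powr a"
      using y r(1) a by (intro powr_mono2) auto
    also have "\<dots> = r powr (a + c * L)"
      using p(2) by (simp add: s_def powr_powr mult.commute)
    also have "\<dots> \<le> T r" by fact
    also have "\<dots> \<le> T y"
      using y r(1) by (intro mono_onD[OF assms(2)]) auto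
    finally show "y \<in> K" using y r(1) R2[of y] by (simp add: K_def)
  qed
  then have "ln s - ln r \<le> (LINT t:K \<inter> {1..s}|lebesgue. 1 / t)"
    using rs r(1) borel_power_window[OF assms(2)]
    by (intro log_measure_ge_Icc) (auto simp: K_def)
  \<comment> \<open>The density bound is used at the right endpoint \<open>s\<close>, where the
    interval just found weighs most.\<close>
  also have "\<dots> < x * ln s"
    using R1[of s] rs r(1) ln_s by (simp add: field_simps)
  also have "\<dots> \<le> c * ln s" using c ln_s(3) by simp
  finally have "(p - 1) * ln r < (c * p) * ln r"
    by (simp add: ln_s algebra_simps)
  then have "p - 1 < c * p" using ln_s by simp
  \<comment> \<open>Since \<open>a * p = a + c * L\<close>, this reads
    \<open>c * L < c * (a + c * L)\<close>, which is impossible because \<open>a + c * L < L\<close>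
    and \<open>c \<ge> 0\<close>.\<close>
  then have "a * (p - 1) < a * (c * p)" using a by simp
  also have "a * (c * p) = c * (a + c * L)" unfolding p(2)[symmetric] by (simp add: mult.left_commute)
  also have "\<dots> \<le> c * L" using a c by (intro mult_left_mono) auto
  finally show False using p(2) by (simp add: algebra_simps)
qed

end
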